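(* Let $d\ge 1$ and $1\le k\le d$ be integers. (i) If $\mathcal F=\{f_1,\dots,f_m\}$ is a set of $m$ vectors in $\mathbb R^d$ that is $k$-sparse phase retrievable on $\mathbb R^d$, then $m\ge \min\{2k,\,2d-1\}$. (ii) Furthermore, if $m\ge \min\{2k,\,2d-1\}$, then a set $\mathcal F=\{f_1,\dots,f_m\}$ of $m$ generically chosen vectors in $\mathbb R^d$ is $k$-sparse phase retrievable.
   Context: Let $\mathbb R^d_k=\{x\in\mathbb R^d:\|x\|_0\le k\}$, where $\|x\|_0$ is the number of nonzero entries of $x$. A family $\mathcal F=\{f_1,\dots,f_m\}$ of vectors in $\mathbb R^d$ is called $k$-sparse phase retrievable if, for all $x,y\in\mathbb R^d_k$, the equalities $|\langle x,f_j\rangle|=|\langle y,f_j\rangle|$ for $j=1,\dots,m$ imply $x=y$ or $x=-y$. "Generically chosen" means: identifying $(f_1,\dots,f_m)$ with a point of $\mathbb R^{d\times m}\cong\mathbb R^{dm}$, the property holds for all points outside some proper real algebraic subset of $\mathbb R^{dm}$ (i.e. outside the common zero set of some family of real polynomials, not all identically zero). *)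

theory Defs
  imports "HOL-Analysis.Analysis"
begin

definition l0norm :: "real ^ 'd \<Rightarrow> nat"
  where "l0norm x = card {i. x $ i \<noteq> 0}"

definition sparse_vectors :: "nat \<Rightarrow> (real ^ 'd) set"
  where "sparse_vectors k = {x. l0norm x \<le> k}"

text \<open>Families \<open>(f j)\<close> are indexed by \<open>j \<in> J\<close>; repetitions are allowed.\<close>

definition sparse_phase_retrievable :: "nat \<Rightarrow> 'j set \<Rightarrow> ('j \<Rightarrow> real ^ 'd) \<Rightarrow> bool"
  where "sparse_phase_retrievable k J f \<longleftrightarrow>
    (\<forall>x \<in> sparse_vectors k. \<forall>y \<in> sparse_vectors k.
      (\<forall>j \<in> J. \<bar>x \<bullet> f j\<bar> = \<bar>y \<bullet> f j\<bar>) \<longrightarrow> x = y \<or> x = - y)"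

text \<open>On a Euclidean space every linear form is bounded, so \<open>real_polynomial_function\<close>
  describes exactly the polynomial functions in the coordinates. The family \<open>P\<close>
  of equations may be infinite.\<close>

definition real_algebraic_set :: "'a::euclidean_space set \<Rightarrow> bool"
  where "real_algebraic_set Z \<longleftrightarrow>
    (\<exists>P. (\<forall>p \<in> P. real_polynomial_function p) \<and> Z = {x. \<forall>p \<in> P. p x = 0})"

definition holds_generically :: "('a::euclidean_space \<Rightarrow> bool) \<Rightarrow> bool"
  where "holds_generically Q \<longleftrightarrow>
    (\<exists>Z. real_algebraic_set Z \<and> Z \<noteq> UNIV \<and> (\<forall>x. x \<notin> Z \<longrightarrow> Q x))"

end

theory Submission
  imports Defs
begin

text \<open>
  With \<open>u = x + y\<close> and \<open>v = x - y\<close>, the equalities \<open>\<bar>x \<bullet> f j\<bar> = \<bar>y \<bullet> f j\<bar>\<close> say that every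
  \<open>f j\<close> is orthogonal to \<open>u\<close> or to \<open>v\<close>.

  Lower bound: split the family in two halves and choose nonzero \<open>u\<close> and \<open>v\<close> orthogonal to one
  half each. For \<open>k < d\<close>, this is done within \<open>k + 1\<close> coordinates, where the family of
  \<open>2 k - 1\<close> vectors leaves one line for \<open>u\<close> and a plane for \<open>v\<close>; the freedom in the plane is
  used to kill one coordinate of \<open>u + v\<close> and one of \<open>u - v\<close>.

  Sufficiency: fix the supports \<open>S\<close>, \<open>T\<close> of \<open>x\<close>, \<open>y\<close> and the set \<open>A\<close> of those \<open>j\<close> with
  \<open>v \<bullet> f j = 0\<close>. If \<open>A\<close> or its complement has at least \<open>card (S \<union> T)\<close> elements, then generically
  \<open>v = 0\<close> or \<open>u = 0\<close>. Otherwise both have at least \<open>card (S \<inter> T)\<close> elements, and the linear system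
  for \<open>(x, y)\<close> generically has only the zero solution. Injectivity of a linear system depending
  polynomially on parameters is the nonvanishing of a Gram determinant, so it holds generically as
  soon as it holds at one point.
\<close>

section \<open>The lower bound\<close>

lemma exists_nonzero_orthogonal:
  fixes W :: "'a::euclidean_space set"
  assumes "finite W" "card W < DIM('a)"
  obtains u where "u \<noteq> 0" "\<And>w. w \<in> W \<Longrightarrow> u \<bullet> w = 0"
proof -
  have "dim W < DIM('a)"
    using dim_le_card'[OF assms(1)] assms(2) by linarith
  then obtain u where "u \<noteq> 0" "\<And>y. y \<in> span W \<Longrightarrow> orthogonal u y"
    using orthogonal_to_subspace_exists by blast
  then show thesis
    using that by (meson orthogonal_def span_base)
qed

text \<open>Vanishing off \<open>S\<close> is orthogonality to the axis vectors of
  \<open>- S\<close>, which leaves fewer linear conditions than the dimension.\<close>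

lemma exists_nonzero_supported_orthogonal:
  fixes W :: "(real ^ 'd::finite) set"
  assumes "finite W" "card W < card S"
  obtains u where "u \<noteq> 0" "\<And>w. w \<in> W \<Longrightarrow> u \<bullet> w = 0" "\<And>i. i \<notin> S \<Longrightarrow> u $ i = 0"
proof -
  let ?E = "(\<lambda>i. axis i 1 :: real ^ 'd) ` (- S)"
  have "card (W \<union> ?E) \<le> card W + card (- S)"
    by (meson add_left_mono card_Un_le card_image_le finite le_trans)
  also have "\<dots> < DIM(real ^ 'd)"
    using assms(2) card_mono[of UNIV S] by (simp add: Compl_eq_Diff_UNIV card_Diff_subset)
  finally obtain u where u: "u \<noteq> 0" "\<And>w. w \<in> W \<union> ?E \<Longrightarrow> u \<bullet> w = 0"
    using exists_nonzero_orthogonal[of "W \<union> ?E"] assms(1) by auto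
  have "u $ i = 0" if "i \<notin> S" for i
    using u(2)[of "axis i 1"] that by (auto simp: inner_axis)
  with u show thesis
    by (intro that[of u]) auto
qed

lemma sparse_vectorsI:
  assumes "card S \<le> k" "\<And>i. i \<notin> S \<Longrightarrow> x $ i = 0"
  shows "(x :: real ^ 'd::finite) \<in> sparse_vectors k"
proof -
  have "card {i. x $ i \<noteq> 0} \<le> card S"
    using assms(2) by (intro card_mono) auto
  with assms(1) show ?thesis
    by (simp add: sparse_vectors_def l0norm_def)
qed

text \<open>The offending pair is \<open>u + v\<close>, \<open>u - v\<close>: orthogonality to
  \<open>u\<close> or to \<open>v\<close> makes the two measurements agree up to sign, while
  equality of the pair up to sign would force \<open>v = 0\<close> or \<open>u = 0\<close>.\<close>

lemma not_sparse_phase_retrievableI: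
  fixes u v :: "real ^ 'd::finite"
  assumes "u \<noteq> 0" "v \<noteq> 0"
    and "u + v \<in> sparse_vectors k" "u - v \<in> sparse_vectors k"
    and "\<And>j. j \<in> J \<Longrightarrow> u \<bullet> f j = 0 \<or> v \<bullet> f j = 0"
  shows "\<not> sparse_phase_retrievable k J f"
proof
  assume "sparse_phase_retrievable k J f"
  moreover have "\<bar>(u + v) \<bullet> f j\<bar> = \<bar>(u - v) \<bullet> f j\<bar>" if "j \<in> J" for j
    using assms(5)[OF that] by (auto simp: inner_add_left inner_diff_left)
  ultimately have "u + v = u - v \<or> u + v = - (u - v)"
    using assms(3,4) unfolding sparse_phase_retrievable_def by blast
  then show False
    using assms(1,2) by (auto simp: vec_eq_iff)
qed

text \<open>At most \<open>2 * d - 2\<close> vectors split into two blocks of at most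
  \<open>d - 1\<close>, each orthogonal to some nonzero vector; sparsity imposes no restriction
  here.\<close>

lemma sparse_phase_retrievable_full_card:
  fixes f :: "nat \<Rightarrow> real ^ 'd::finite"
  assumes "sparse_phase_retrievable CARD('d) {1..m} f"
  shows "2 * CARD('d) - 1 \<le> m"
proof (rule ccontr)
  assume less: "\<not> 2 * CARD('d) - 1 \<le> m"
  define d where "d = CARD('d)"
  have d: "0 < d" "DIM(real ^ 'd) = d"
    by (auto simp: d_def)
  have "card (f ` {1..d - 1}) < d" "card (f ` {d..m}) < d"
    using d(1) less
      card_image_le[of "{1..d - 1}" f] card_image_le[of "{d..m}" f] by (auto simp: d_def)
  then obtain u v where "u \<noteq> 0" "v \<noteq> 0"
    and "\<And>w. w \<in> f ` {1..d - 1} \<Longrightarrow> u \<bullet> w = 0" "\<And>w. w \<in> f ` {d..m} \<Longrightarrow> v \<bullet> w = 0"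
    using exists_nonzero_orthogonal[of "f ` {1..d - 1}"]
      exists_nonzero_orthogonal[of "f ` {d..m}"] d(2) by (metis finite_atLeastAtMost finite_imageI)
  moreover have "x \<in> sparse_vectors CARD('d)" for x :: "real ^ 'd"
    by (rule sparse_vectorsI[of UNIV]) auto
  moreover have "j \<in> {1..d - 1} \<or> j \<in> {d..m}" if "j \<in> {1..m}" for j
    using that by auto
  ultimately show False
    using not_sparse_phase_retrievableI[of u v "CARD('d)" "{1..m}" f] assms by blast
qed

lemma sparse_phase_retrievable_card:
  fixes f :: "nat \<Rightarrow> real ^ 'd::finite"
  assumes "1 \<le> k" "k < CARD('d)" "sparse_phase_retrievable k {1..m} f"
  shows "2 * k \<le> m"
proof (rule ccontr)
  assume less: "\<not> 2 * k \<le> m"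
  obtain S :: "'d set" where S: "card S = k + 1"
    using obtain_subset_with_card_n[of "k + 1" "UNIV :: 'd set"] assms(2) by auto
  let ?A = "f ` {1..k}" and ?B = "f ` {k + 1..m}"
  have A: "card ?A \<le> k" and B: "card ?B \<le> k - 1"
    using card_image_le[of "{1..k}" f] card_image_le[of "{k + 1..m}" f] less by auto
  obtain u where u: "u \<noteq> 0" "\<And>w. w \<in> ?A \<Longrightarrow> u \<bullet> w = 0" "\<And>i. i \<notin> S \<Longrightarrow> u $ i = 0"
    using exists_nonzero_supported_orthogonal[of ?A S] A S by auto
  \<comment> \<open>The solutions \<open>v\<close> supported in \<open>S\<close> form at least a
    plane, so any one coordinate can be made zero: at most \<open>k\<close> conditions on
    \<open>k + 1\<close> coordinates.\<close>
  have V: thesis if "\<And>v. \<lbrakk>v \<noteq> 0; \<And>w. w \<in> ?B \<Longrightarrow> v \<bullet> w = 0; \<And>l. l \<notin> S \<Longrightarrow> v $ l = 0; v $ i = 0\<rbrakk> \<Longrightarrow> thesis"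
    for i thesis
  proof -
    have "card (insert (axis i 1) ?B) < card S"
      using B S assms(1) card_insert_le_m1[of k ?B "axis i 1"] by auto
    then obtain v where "v \<noteq> 0" "\<And>w. w \<in> insert (axis i 1) ?B \<Longrightarrow> v \<bullet> w = 0"
        "\<And>l. l \<notin> S \<Longrightarrow> v $ l = 0"
      using exists_nonzero_supported_orthogonal[of "insert (axis i 1) ?B" S] by blast
    moreover from this(2)[of "axis i 1"] have "v $ i = 0"
      by (simp add: inner_axis)
    ultimately show thesis
      using that by blast
  qed
  \<comment> \<open>The support lies in \<open>S\<close>, of size \<open>k + 1\<close>, so a single
    zero inside \<open>S\<close> makes each of \<open>u + v\<close> and \<open>u - v\<close>
    \<open>k\<close>-sparse.\<close>
  have contra: False if v: "v \<noteq> 0" "\<And>w. w \<in> ?B \<Longrightarrow> v \<bullet> w = 0" "\<And>l. l \<notin> S \<Longrightarrow> v $ l = 0"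
    and ij: "i \<in> S" "(u + v) $ i = 0" "j \<in> S" "(u - v) $ j = 0" for v i j
  proof -
    have "u + v \<in> sparse_vectors k"
      using S ij u(3) v(3) by (intro sparse_vectorsI[of "S - {i}"]) auto
    moreover have "u - v \<in> sparse_vectors k"
      using S ij u(3) v(3) by (intro sparse_vectorsI[of "S - {j}"]) auto
    moreover have "u \<bullet> f l = 0 \<or> v \<bullet> f l = 0" if "l \<in> {1..m}" for l
      using u(2)[of "f l"] v(2)[of "f l"] that by (cases "l \<le> k") auto
    ultimately show False
      using not_sparse_phase_retrievableI[of u v k "{1..m}" f] u(1) v(1) assms(3) by blast
  qed
  show False
  proof (cases "\<exists>i\<in>S. u $ i = 0")
    case True
    \<comment> \<open>A common zero of \<open>u\<close> and \<open>v\<close> at \<open>i\<close>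
      serves both the sum and the difference.\<close>
    then obtain i where i: "i \<in> S" "u $ i = 0"
      by blast
    show False
    proof (rule V[of i])
      fix v
      assume "v \<noteq> 0" "\<And>w. w \<in> ?B \<Longrightarrow> v \<bullet> w = 0" "\<And>l. l \<notin> S \<Longrightarrow> v $ l = 0" "v $ i = 0"
      then show False
        using i by (intro contra[of v i i]) auto
    qed
  next
    case False
    obtain p where p: "p \<noteq> 0" "\<And>w. w \<in> ?B \<Longrightarrow> p \<bullet> w = 0" "\<And>l. l \<notin> S \<Longrightarrow> p $ l = 0"
      using V by metis
    then obtain i where i: "p $ i \<noteq> 0"
      by (auto simp: vec_eq_iff)
    \<comment> \<open>Since \<open>q\<close> vanishes at a coordinate where \<open>p\<close> does
      not, the system for the coefficients of \<open>p\<close> and \<open>q\<close> is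
      triangular.\<close>
    obtain q where q: "q \<noteq> 0" "\<And>w. w \<in> ?B \<Longrightarrow> q \<bullet> w = 0" "\<And>l. l \<notin> S \<Longrightarrow> q $ l = 0" "q $ i = 0"
      using V by metis
    then obtain j where j: "q $ j \<noteq> 0"
      by (auto simp: vec_eq_iff)
    \<comment> \<open>The coefficients solve \<open>?v $ i = - u $ i\<close> and
      \<open>?v $ j = u $ j\<close>. Since \<open>u\<close> has no zero in \<open>S\<close>, this
      also gives \<open>?v \<noteq> 0\<close>.\<close>
    define a where "a = - u $ i / p $ i"
    define b where "b = (u $ j - a * p $ j) / q $ j"
    let ?v = "a *\<^sub>R p + b *\<^sub>R q"
    have S': "i \<in> S" "j \<in> S"
      using i j p(3) q(3) by blast+
    have vi: "?v $ i = - u $ i" and vj: "?v $ j = u $ j"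
      using i j q(4) by (simp_all add: a_def b_def)
    moreover have "?v \<noteq> 0"
      using vi False S' by (metis neg_equal_0_iff_equal vector_uminus_component zero_index)
    ultimately show False
      using p q S' by (intro contra[of ?v i j]) (auto simp: inner_add_left)
  qed
qed

section \<open>Generic properties\<close>

text \<open>At a point outside the algebraic set some polynomial of the family is nonzero, and the
  zero set of that one polynomial contains the whole set.\<close>

lemma holds_generically_iff:
  "holds_generically Q \<longleftrightarrow>
    (\<exists>p. real_polynomial_function p \<and> (\<exists>x. p x \<noteq> 0) \<and> (\<forall>x. p x \<noteq> 0 \<longrightarrow> Q x))"
proof
  assume "holds_generically Q"
  then obtain P where P: "\<forall>p\<in>P. real_polynomial_function p" "{x. \<forall>p\<in>P. p x = 0} \<noteq> UNIV"
    "\<forall>x. x \<notin> {x. \<forall>p\<in>P. p x = 0} \<longrightarrow> Q x"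
    unfolding holds_generically_def real_algebraic_set_def by auto
  then show "\<exists>p. real_polynomial_function p \<and> (\<exists>x. p x \<noteq> 0) \<and> (\<forall>x. p x \<noteq> 0 \<longrightarrow> Q x)"
    by blast
next
  assume "\<exists>p. real_polynomial_function p \<and> (\<exists>x. p x \<noteq> 0) \<and> (\<forall>x. p x \<noteq> 0 \<longrightarrow> Q x)"
  then obtain p where "real_polynomial_function p" "\<exists>x. p x \<noteq> 0" "\<forall>x. p x \<noteq> 0 \<longrightarrow> Q x"
    by blast
  then show "holds_generically Q"
    unfolding holds_generically_def real_algebraic_set_def
    by (intro exI[of _ "{x. \<forall>q\<in>{p}. q x = 0}"]) auto
qed

lemma holds_generically_mono:
  assumes "holds_generically Q" "\<And>x. Q x \<Longrightarrow> R x"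
  shows "holds_generically R"
  using assms unfolding holds_generically_def by blast

lemma finite_roots_real_polynomial_function:
  fixes p :: "real \<Rightarrow> real"
  assumes "real_polynomial_function p" "p a \<noteq> 0"
  shows "finite {t. p t = 0}"
proof -
  obtain c n where p: "p = (\<lambda>x. \<Sum>i\<le>n. c i * x ^ i)"
    using assms(1) real_polynomial_function_iff_sum by blast
  with assms(2) obtain i where "i \<le> n" "c i \<noteq> 0"
    by (metis (no_types, lifting) atMost_iff mult_zero_left sum.neutral)
  then show ?thesis
    unfolding p using polyfun_roots_finite[of c i n] by blast
qed

lemma real_polynomial_function_line:
  fixes p :: "'a::euclidean_space \<Rightarrow> real"
  assumes "real_polynomial_function p"
  shows "real_polynomial_function (\<lambda>t. p (a + t *\<^sub>R b))"
proof -
  have "polynomial_function (\<lambda>t. a + t *\<^sub>R b)"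
    by (intro polynomial_function_add polynomial_function_const polynomial_function_mult)
      (auto intro: polynomial_function_bounded_linear bounded_linear_ident)
  from real_polynomial_function_compose[OF this assms] show ?thesis
    by (simp add: o_def)
qed

text \<open>The product of the two polynomials is the witness. It is not identically zero: on the
  line through \<open>a\<close> and \<open>b\<close> each factor is a nonzero polynomial in one
  variable, at \<open>t = 0\<close> and \<open>t = 1\<close> respectively, hence has finitely many
  roots.\<close>

lemma holds_generically_conj:
  fixes Q R :: "'a::euclidean_space \<Rightarrow> bool"
  assumes "holds_generically Q" "holds_generically R"
  shows "holds_generically (\<lambda>x. Q x \<and> R x)"
proof -
  obtain p a where p: "real_polynomial_function p" "p a \<noteq> 0" "\<And>x. p x \<noteq> 0 \<Longrightarrow> Q x"
    using assms(1) by (auto simp: holds_generically_iff)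
  obtain q b where q: "real_polynomial_function q" "q b \<noteq> 0" "\<And>x. q x \<noteq> 0 \<Longrightarrow> R x"
    using assms(2) by (auto simp: holds_generically_iff)
  let ?l = "\<lambda>t. a + t *\<^sub>R (b - a)"
  have "finite {t. p (?l t) = 0}" "finite {t. q (?l t) = 0}"
    using p q by (auto intro: finite_roots_real_polynomial_function[where a = 0]
        finite_roots_real_polynomial_function[where a = 1] real_polynomial_function_line)
  then have "{t. p (?l t) = 0} \<union> {t. q (?l t) = 0} \<noteq> UNIV"
    using infinite_UNIV_char_0 by (metis finite_UnI)
  then obtain t where "p (?l t) \<noteq> 0" "q (?l t) \<noteq> 0"
    by blast
  then show ?thesis
    unfolding holds_generically_iff using p q
    by (intro exI[of _ "\<lambda>x. p x * q x"]) (auto intro: real_polynomial_function.intros(4))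
qed

lemma holds_generically_ball:
  assumes "finite I" "\<And>i. i \<in> I \<Longrightarrow> holds_generically (Q i)"
  shows "holds_generically (\<lambda>x. \<forall>i\<in>I. Q i x)"
  using assms
proof (induction rule: finite_induct)
  case empty
  show ?case
    unfolding holds_generically_iff
    by (intro exI[of _ "\<lambda>x. 1"]) (auto intro: real_polynomial_function.intros(2))
next
  case (insert i I)
  then show ?case
    using holds_generically_conj[of "Q i" "\<lambda>x. \<forall>i\<in>I. Q i x"] by auto
qed

section \<open>Polynomially parametrised linear systems\<close>

lemma real_polynomial_function_det:
  fixes M :: "'a::euclidean_space \<Rightarrow> real ^ 'n ^ 'n"
  assumes "\<And>i j. real_polynomial_function (\<lambda>x. M x $ i $ j)"
  shows "real_polynomial_function (\<lambda>x. det (M x))"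
  unfolding det_def
  by (intro real_polynomial_function_sum real_polynomial_function_prod
      real_polynomial_function.intros(4) real_polynomial_function.intros(2) assms) auto

text \<open>For the matrix \<open>H\<close> with rows \<open>h g\<close>, this is the transpose of
  \<open>H\<close> times \<open>H\<close>: square for any number of rows, so that a determinant
  exists.\<close>

definition gram :: "'r set \<Rightarrow> ('r \<Rightarrow> real ^ 'n) \<Rightarrow> real ^ 'n ^ 'n"
  where "gram G h = (\<chi> i j. \<Sum>g\<in>G. h g $ i * h g $ j)"

lemma gram_mult_vector: "gram G h *v z = (\<Sum>g\<in>G. (h g \<bullet> z) *\<^sub>R h g)"
  unfolding gram_def matrix_vector_mult_def
  by (simp add: vec_eq_iff inner_vec_def sum_distrib_left sum_distrib_right)
    (subst sum.swap, simp add: mult_ac)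

text \<open>The quadratic form of the Gram matrix at \<open>z\<close> is the sum of the squares of
  \<open>h g \<bullet> z\<close>, so its kernel is the solution space of the system.\<close>

lemma det_gram_nonzero_iff:
  fixes h :: "'r \<Rightarrow> real ^ 'n"
  assumes "finite G"
  shows "det (gram G h) \<noteq> 0 \<longleftrightarrow> (\<forall>z. (\<forall>g\<in>G. h g \<bullet> z = 0) \<longrightarrow> z = 0)"
proof -
  have "gram G h *v z = 0 \<longleftrightarrow> (\<forall>g\<in>G. h g \<bullet> z = 0)" for z
  proof
    assume "gram G h *v z = 0"
    then have "0 = z \<bullet> (gram G h *v z)"
      by simp
    also have "\<dots> = (\<Sum>g\<in>G. (h g \<bullet> z)\<^sup>2)"
      by (simp add: gram_mult_vector inner_sum_right power2_eq_square inner_commute)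
    finally show "\<forall>g\<in>G. h g \<bullet> z = 0"
      using assms by (simp add: sum_nonneg_eq_0_iff)
  qed (simp add: gram_mult_vector)
  then show ?thesis
    by (metis invertible_det_nz invertible_left_inverse matrix_left_invertible_ker)
qed

text \<open>The Gram determinant is a polynomial in the parameter, and the point \<open>a\<close>
  shows that it is not identically zero.\<close>

lemma holds_generically_injective:
  fixes G :: "('a::euclidean_space \<Rightarrow> real ^ 'n) set"
  assumes "finite G"
    and "\<And>g i. g \<in> G \<Longrightarrow> real_polynomial_function (\<lambda>x. g x $ i)"
    and "\<And>z. (\<And>g. g \<in> G \<Longrightarrow> g a \<bullet> z = 0) \<Longrightarrow> z = 0"
  shows "holds_generically (\<lambda>x. \<forall>z. (\<forall>g\<in>G. g x \<bullet> z = 0) \<longrightarrow> z = 0)"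
  unfolding holds_generically_iff
proof (intro exI[of _ "\<lambda>x. det (gram G (\<lambda>g. g x))"] conjI allI impI)
  show "real_polynomial_function (\<lambda>x. det (gram G (\<lambda>g. g x)))"
    using assms(1,2) by (intro real_polynomial_function_det)
      (auto simp: gram_def intro!: real_polynomial_function_sum real_polynomial_function.intros(4))
  show "\<exists>x. det (gram G (\<lambda>g. g x)) \<noteq> 0"
    using assms(3) det_gram_nonzero_iff[OF assms(1), of "\<lambda>g. g a"] by blast
next
  fix x z
  assume "det (gram G (\<lambda>g. g x)) \<noteq> 0" "\<forall>g\<in>G. g x \<bullet> z = 0"
  then show "z = 0"
    using det_gram_nonzero_iff[OF assms(1), of "\<lambda>g. g x"] by blast
qed

section \<open>Sufficiency of generic families\<close>

lemma real_polynomial_function_entry: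
  "real_polynomial_function (\<lambda>F :: (real ^ 'd) ^ 'm. F $ j $ i)"
  by (intro real_polynomial_function.intros(1)
      bounded_linear_compose[OF bounded_linear_vec_nth bounded_linear_vec_nth])

lemma holds_generically_orthogonal_imp_zero:
  fixes U :: "'d::finite set" and A :: "'m::finite set"
  assumes "card U \<le> card A"
  shows "holds_generically (\<lambda>F :: (real ^ 'd) ^ 'm.
    \<forall>u. (\<forall>i. i \<notin> U \<longrightarrow> u $ i = 0) \<and> (\<forall>j\<in>A. u \<bullet> F $ j = 0) \<longrightarrow> u = 0)"
proof -
  obtain s where s: "inj_on s U" "s ` U \<subseteq> A"
    using assms by (metis card_le_inj finite)
  define F0 :: "(real ^ 'd) ^ 'm" where "F0 = (\<chi> j. axis (inv_into U s j) 1)"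
  \<comment> \<open>The support condition enters the system as constant rows.\<close>
  define G :: "((real ^ 'd) ^ 'm \<Rightarrow> real ^ 'd) set"
    where "G = (\<lambda>j F. F $ j) ` A \<union> (\<lambda>i F. axis i 1) ` (- U)"
  have "holds_generically (\<lambda>F. \<forall>z. (\<forall>g\<in>G. g F \<bullet> z = 0) \<longrightarrow> z = 0)"
  proof (rule holds_generically_injective[where a = F0])
    show "real_polynomial_function (\<lambda>x. g x $ i)" if "g \<in> G" for g i
      using that unfolding G_def
      by (auto intro: real_polynomial_function_entry real_polynomial_function.intros(2))
  next
    fix z
    assume z: "\<And>g. g \<in> G \<Longrightarrow> g F0 \<bullet> z = 0"
    have "z $ i = 0" for i
    proof (cases "i \<in> U")
      case True
      then show ?thesis
        using z[of "\<lambda>F. F $ s i"] s by (auto simp: G_def F0_def inner_axis' )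
    next
      case False
      then show ?thesis
        using z[of "\<lambda>F. axis i 1"] by (auto simp: G_def inner_axis')
    qed
    then show "z = 0"
      by (simp add: vec_eq_iff)
  qed (simp add: G_def)
  then show ?thesis
    by (rule holds_generically_mono) (auto simp: G_def inner_commute inner_axis)
qed

text \<open>Packing \<open>(x, y)\<close> into one vector over the sum type turns the joint
  conditions into a single linear system for the Gram criterion.\<close>

definition pair_vec :: "real ^ 'd \<Rightarrow> real ^ 'd \<Rightarrow> real ^ ('d + 'd)"
  where "pair_vec x y = (\<chi> c. case_sum (($) x) (($) y) c)"

lemma inner_pair_vec:
  fixes x y a b :: "real ^ 'd::finite"
  shows "pair_vec x y \<bullet> pair_vec a b = x \<bullet> a + y \<bullet> b"
  by (simp add: inner_vec_def pair_vec_def UNIV_Plus_UNIV[symmetric] sum.Plus del: UNIV_Plus_UNIV)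

lemma pair_vec_exhaust:
  fixes z :: "real ^ ('d::finite + 'd)"
  obtains x y where "z = pair_vec x y"
proof
  show "z = pair_vec (\<chi> i. z $ Inl i) (\<chi> i. z $ Inr i)"
    by (auto simp: vec_eq_iff pair_vec_def split: sum.split)
qed

lemma pair_vec_eq_0_iff: "pair_vec x y = 0 \<longleftrightarrow> x = 0 \<and> y = 0"
  by (force simp: vec_eq_iff pair_vec_def split: sum.split)

text \<open>The witness puts two copies of each axis vector of \<open>S \<inter> T\<close> into the
  family, one in \<open>A\<close> and one in \<open>- A\<close>, and one copy of each axis vector of
  the symmetric difference anywhere else. This takes \<open>card S + card T\<close> places.\<close>

lemma holds_generically_pair_imp_zero:
  fixes S T :: "'d::finite set" and A :: "'m::finite set"
  assumes A: "card (S \<inter> T) \<le> card A" and B: "card (S \<inter> T) \<le> card (- A)"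
    and m: "card S + card T \<le> CARD('m)"
  shows "holds_generically (\<lambda>F :: (real ^ 'd) ^ 'm. \<forall>x y.
    (\<forall>i. i \<notin> S \<longrightarrow> x $ i = 0) \<and> (\<forall>i. i \<notin> T \<longrightarrow> y $ i = 0) \<and>
    (\<forall>j\<in>A. (x - y) \<bullet> F $ j = 0) \<and> (\<forall>j\<in>-A. (x + y) \<bullet> F $ j = 0) \<longrightarrow> x = 0 \<and> y = 0)"
proof -
  define I where "I = S \<inter> T"
  define D where "D = S \<union> T - I"
  obtain p where p: "inj_on p I" "p ` I \<subseteq> A"
    using A unfolding I_def by (metis card_le_inj finite)
  obtain q where q: "inj_on q I" "q ` I \<subseteq> - A"
    using B unfolding I_def by (metis card_le_inj finite)
  have disj: "p ` I \<inter> q ` I = {}"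
    using p(2) q(2) by blast
  have "card D + card I = card (S \<union> T)"
    unfolding D_def I_def by (subst card_Diff_subset) (auto intro!: le_add_diff_inverse2 card_mono)
  moreover have "card (S \<union> T) + card I = card S + card T"
    unfolding I_def by (simp add: card_Un_Int[symmetric])
  moreover have "card (- (p ` I \<union> q ` I)) = CARD('m) - 2 * card I"
    using p(1) q(1) disj by (simp add: Compl_eq_Diff_UNIV card_Diff_subset card_Un_disjoint card_image)
  ultimately have "card D \<le> card (- (p ` I \<union> q ` I))"
    using m by linarith
  then obtain r where r: "inj_on r D" "r ` D \<subseteq> - (p ` I \<union> q ` I)"
    by (metis card_le_inj finite)
  define F0 :: "(real ^ 'd) ^ 'm" where
    "F0 = (\<chi> j. axis (if j \<in> p ` I then inv_into I p j
                   else if j \<in> q ` I then inv_into I q j else inv_into D r j) 1)"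
  have F0: "i \<in> I \<Longrightarrow> F0 $ p i = axis i 1" "i \<in> I \<Longrightarrow> F0 $ q i = axis i 1"
    "i \<in> D \<Longrightarrow> F0 $ r i = axis i 1" for i
    using p(1) q(1) r disj by (auto simp: F0_def)
  define G :: "((real ^ 'd) ^ 'm \<Rightarrow> real ^ ('d + 'd)) set"
    where "G = (\<lambda>j F. pair_vec (F $ j) (- F $ j)) ` A \<union> (\<lambda>j F. pair_vec (F $ j) (F $ j)) ` (- A)
      \<union> (\<lambda>i F. pair_vec (axis i 1) 0) ` (- S) \<union> (\<lambda>i F. pair_vec 0 (axis i 1)) ` (- T)"
  have G: "(\<forall>g\<in>G. g F \<bullet> pair_vec x y = 0) \<longleftrightarrow>
    (\<forall>i. i \<notin> S \<longrightarrow> x $ i = 0) \<and> (\<forall>i. i \<notin> T \<longrightarrow> y $ i = 0) \<and>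
    (\<forall>j\<in>A. (x - y) \<bullet> F $ j = 0) \<and> (\<forall>j\<in>-A. (x + y) \<bullet> F $ j = 0)" for F x y
    unfolding G_def ball_Un ball_simps
    by (auto simp: inner_pair_vec inner_axis' inner_diff_left inner_add_left
        inner_commute[of "F $ _"])
  have "holds_generically (\<lambda>F. \<forall>z. (\<forall>g\<in>G. g F \<bullet> z = 0) \<longrightarrow> z = 0)"
  proof (rule holds_generically_injective[where a = F0])
    show "real_polynomial_function (\<lambda>x. g x $ c)" if "g \<in> G" for g c
      using that unfolding G_def
      by (cases c) (auto simp: pair_vec_def intro!: real_polynomial_function_entry
          real_polynomial_function_minus real_polynomial_function.intros(2))
  next
    fix z
    assume z: "\<And>g. g \<in> G \<Longrightarrow> g F0 \<bullet> z = 0"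
    obtain x y where xy: "z = pair_vec x y"
      by (rule pair_vec_exhaust)
    from z G[of F0 x y] have supp: "\<And>i. i \<notin> S \<Longrightarrow> x $ i = 0" "\<And>i. i \<notin> T \<Longrightarrow> y $ i = 0"
      and eqs: "\<And>j. j \<in> A \<Longrightarrow> (x - y) \<bullet> F0 $ j = 0" "\<And>j. j \<notin> A \<Longrightarrow> (x + y) \<bullet> F0 $ j = 0"
      unfolding xy by auto
    have "x $ i = 0 \<and> y $ i = 0" for i
    proof -
      consider "i \<in> I" | "i \<in> D" | "i \<notin> S \<union> T"
        by (auto simp: D_def)
      then show ?thesis
      proof cases
        case 1
        then have "x $ i - y $ i = 0" "x $ i + y $ i = 0"
          using eqs(1)[of "p i"] eqs(2)[of "q i"] p(2) q(2) F0 by (auto simp: inner_axis)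
        then show ?thesis
          by auto
      next
        case 2
        \<comment> \<open>The index \<open>r i\<close> may lie in \<open>A\<close> or in
          \<open>- A\<close>; either equation suffices, as one of the two coordinates is already
          zero.\<close>
        then have "x $ i - y $ i = 0 \<or> x $ i + y $ i = 0"
          using eqs[of "r i"] F0(3) by (auto simp: inner_axis)
        moreover have "x $ i = 0 \<or> y $ i = 0"
          using 2 supp by (auto simp: D_def I_def)
        ultimately show ?thesis
          by auto
      qed (use supp in auto)
    qed
    then show "z = 0"
      unfolding xy pair_vec_eq_0_iff by (simp add: vec_eq_iff)
  qed (simp add: G_def)
  then show ?thesis
    by (rule holds_generically_mono) (metis G pair_vec_eq_0_iff)
qed

lemma holds_generically_eq_or_neg:
  fixes S T :: "'d::finite set" and A :: "'m::finite set"
  assumes "card S \<le> k" "card T \<le> k"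
    and m: "min (2 * k) (2 * CARD('d) - 1) \<le> CARD('m)"
  shows "holds_generically (\<lambda>F :: (real ^ 'd) ^ 'm. \<forall>x y.
    (\<forall>i. i \<notin> S \<longrightarrow> x $ i = 0) \<and> (\<forall>i. i \<notin> T \<longrightarrow> y $ i = 0) \<and>
    (\<forall>j\<in>A. (x - y) \<bullet> F $ j = 0) \<and> (\<forall>j\<in>-A. (x + y) \<bullet> F $ j = 0) \<longrightarrow> x = y \<or> x = - y)"
proof -
  have AB: "card A + card (- A) = CARD('m)"
    using card_mono[of UNIV A] by (simp add: Compl_eq_Diff_UNIV card_Diff_subset)
  consider "card (S \<union> T) \<le> card A" | "card (S \<union> T) \<le> card (- A)"
    | "card A < card (S \<union> T)" "card (- A) < card (S \<union> T)"
    by linarith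
  then show ?thesis
  proof cases
    case 1
    show ?thesis
    proof (rule holds_generically_mono[OF holds_generically_orthogonal_imp_zero[OF 1]], safe)
      fix F :: "(real ^ 'd) ^ 'm" and x y
      assume *: "\<forall>u. (\<forall>i. i \<notin> S \<union> T \<longrightarrow> u $ i = 0) \<and> (\<forall>j\<in>A. u \<bullet> F $ j = 0) \<longrightarrow> u = 0"
        "\<forall>i. i \<notin> S \<longrightarrow> x $ i = 0" "\<forall>i. i \<notin> T \<longrightarrow> y $ i = 0" "\<forall>j\<in>A. (x - y) \<bullet> F $ j = 0"
      have "x - y = 0"
        using *(2-) by (intro *(1)[rule_format]) auto
      then show "x = y"
        by simp
    qed
  next
    case 2
    show ?thesis
    proof (rule holds_generically_mono[OF holds_generically_orthogonal_imp_zero[OF 2]],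
        intro allI impI disjI2)
      fix F :: "(real ^ 'd) ^ 'm" and x y
      assume *: "\<forall>u. (\<forall>i. i \<notin> S \<union> T \<longrightarrow> u $ i = 0) \<and> (\<forall>j\<in>-A. u \<bullet> F $ j = 0) \<longrightarrow> u = 0"
        "(\<forall>i. i \<notin> S \<longrightarrow> x $ i = 0) \<and> (\<forall>i. i \<notin> T \<longrightarrow> y $ i = 0) \<and>
         (\<forall>j\<in>A. (x - y) \<bullet> F $ j = 0) \<and> (\<forall>j\<in>-A. (x + y) \<bullet> F $ j = 0)"
      have "x + y = 0"
        using *(2) by (intro *(1)[rule_format]) auto
      then show "x = - y"
        by (simp add: eq_neg_iff_add_eq_0)
    qed
  next
    case 3
    have "card (S \<union> T) \<le> CARD('d)"
      by (intro card_mono) auto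
    \<comment> \<open>Both parts have at most \<open>CARD('d) - 1\<close> elements, so
      \<open>CARD('m) < 2 * CARD('d) - 1\<close> and the minimum must be
      \<open>2 * k\<close>.\<close>
    then have "2 * k \<le> CARD('m)"
      using 3 m AB by linarith
    then have "card S + card T \<le> CARD('m)"
      using assms(1,2) by linarith
    moreover have "card (S \<union> T) + card (S \<inter> T) = card S + card T"
      by (simp add: card_Un_Int[symmetric])
    \<comment> \<open>As \<open>CARD('m)\<close> is at least
      \<open>card (S \<union> T) + card (S \<inter> T)\<close>, a part smaller than
      \<open>card (S \<union> T)\<close> leaves more than \<open>card (S \<inter> T)\<close> indices
      for the other.\<close>
    ultimately have "holds_generically (\<lambda>F :: (real ^ 'd) ^ 'm. \<forall>x y.
      (\<forall>i. i \<notin> S \<longrightarrow> x $ i = 0) \<and> (\<forall>i. i \<notin> T \<longrightarrow> y $ i = 0) \<and>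
      (\<forall>j\<in>A. (x - y) \<bullet> F $ j = 0) \<and> (\<forall>j\<in>-A. (x + y) \<bullet> F $ j = 0) \<longrightarrow> x = 0 \<and> y = 0)"
      using 3 AB by (intro holds_generically_pair_imp_zero) linarith+
    then show ?thesis
      by (rule holds_generically_mono) (metis neg_equal_zero)
  qed
qed

text \<open>There are only finitely many triples \<open>(S, T, A)\<close>, so the generic conditions
  for all of them hold simultaneously; a given pair \<open>x\<close>, \<open>y\<close> is then
  handled by its own supports and the set of \<open>j\<close> with
  \<open>(x - y) \<bullet> F $ j = 0\<close>.\<close>

lemma holds_generically_sparse_phase_retrievable:
  assumes m: "min (2 * k) (2 * CARD('d::finite) - 1) \<le> CARD('m::finite)"
  shows "holds_generically (\<lambda>F :: (real ^ 'd) ^ 'm. sparse_phase_retrievable k UNIV (\<lambda>j. F $ j))"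
proof -
  define I :: "('d set \<times> 'd set \<times> 'm set) set"
    where "I = {(S, T, A). card S \<le> k \<and> card T \<le> k}"
  define Q where "Q = (\<lambda>(S :: 'd set, T :: 'd set, A :: 'm set) (F :: (real ^ 'd) ^ 'm). \<forall>x y.
    (\<forall>i. i \<notin> S \<longrightarrow> x $ i = 0) \<and> (\<forall>i. i \<notin> T \<longrightarrow> y $ i = 0) \<and>
    (\<forall>j\<in>A. (x - y) \<bullet> F $ j = 0) \<and> (\<forall>j\<in>-A. (x + y) \<bullet> F $ j = 0) \<longrightarrow> x = y \<or> x = - y)"
  have "holds_generically (\<lambda>F. \<forall>t\<in>I. Q t F)"
  proof (rule holds_generically_ball)
    fix t
    assume "t \<in> I"
    then obtain S T A where "t = (S, T, A)" "card S \<le> k" "card T \<le> k"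
      by (auto simp: I_def)
    then show "holds_generically (Q t)"
      using holds_generically_eq_or_neg[OF _ _ m, of S T A] by (simp add: Q_def)
  qed simp
  then show ?thesis
  proof (rule holds_generically_mono)
    fix F :: "(real ^ 'd) ^ 'm"
    assume Q: "\<forall>t\<in>I. Q t F"
    show "sparse_phase_retrievable k UNIV (\<lambda>j. F $ j)"
      unfolding sparse_phase_retrievable_def
    proof (intro ballI impI)
      fix x y :: "real ^ 'd"
      assume x: "x \<in> sparse_vectors k" and y: "y \<in> sparse_vectors k"
        and eq: "\<forall>j\<in>UNIV. \<bar>x \<bullet> F $ j\<bar> = \<bar>y \<bullet> F $ j\<bar>"
      let ?A = "{j. (x - y) \<bullet> F $ j = 0}"
      have "({i. x $ i \<noteq> 0}, {i. y $ i \<noteq> 0}, ?A) \<in> I"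
        using x y by (simp add: I_def sparse_vectors_def l0norm_def)
      with Q have "Q ({i. x $ i \<noteq> 0}, {i. y $ i \<noteq> 0}, ?A) F"
        by blast
      moreover have "(x + y) \<bullet> F $ j = 0" if "j \<notin> ?A" for j
        using eq that by (auto simp: abs_eq_iff inner_add_left inner_diff_left)
      ultimately show "x = y \<or> x = - y"
        unfolding Q_def by auto
    qed
  qed
qed

theorem theorem2p1:
  fixes k :: nat
  assumes "1 \<le> k" and "k \<le> CARD('d::finite)"
  shows "(\<forall>(m::nat) (f :: nat \<Rightarrow> real ^ 'd).
            sparse_phase_retrievable k {1..m} f \<longrightarrow> m \<ge> min (2 * k) (2 * CARD('d) - 1))
       \<and> (CARD('m::finite) \<ge> min (2 * k) (2 * CARD('d) - 1) \<longrightarrow>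
            holds_generically (\<lambda>F :: (real ^ 'd) ^ 'm. sparse_phase_retrievable k UNIV (\<lambda>j. F $ j)))"
proof (intro conjI allI impI)
  fix m and f :: "nat \<Rightarrow> real ^ 'd"
  assume f: "sparse_phase_retrievable k {1..m} f"
  show "min (2 * k) (2 * CARD('d) - 1) \<le> m"
  proof (cases "k = CARD('d)")
    case True
    then show ?thesis
      using sparse_phase_retrievable_full_card[of m f] f by simp
  next
    case False
    then show ?thesis
      using sparse_phase_retrievable_card[of k m f] f assms by simp
  qed
qed (rule holds_generically_sparse_phase_retrievable)

end
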